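(* Let $q\ge 2$ and $k\ge 1$ be integers, and let $F:A^{\mathbb{Z}^d}\to A^{\mathbb{Z}^d}$ be a cellular automaton. If there exists a continuous map $\pi:A^{\mathbb{Z}^d}\to(\mathbb{Z}/q\mathbb{Z})^{\mathbb{Z}^k}$ such that $\pi\circ F=C_q^{(k)}\circ\pi$, then for every $x\in A^{\mathbb{Z}^d}$ and every integer $n\ge 1$, $F^n(x)=x$ implies $q\mid n$. In particular, every periodic point of $F$ has least period divisible by $q$.
   Context: A cellular automaton $F:A^{\mathbb{Z}^d}\to A^{\mathbb{Z}^d}$ ($d\ge 1$, $A$ a finite nonempty alphabet) is a map that is continuous for the product topology (with $A$ discrete) and commutes with all spatial shifts of $\mathbb{Z}^d$. A periodic point of $F$ is a configuration $x$ with $F^n(x)=x$ for some $n\ge 1$; its least period is the smallest such $n$. For integers $q\ge 2$ and $k\ge 1$, the radius-zero $q$-clock automaton $C_q^{(k)}:(\mathbb{Z}/q\mathbb{Z})^{\mathbb{Z}^k}\to(\mathbb{Z}/q\mathbb{Z})^{\mathbb{Z}^k}$ is defined by $(C_q^{(k)}(x))_v=x_v+1 \pmod q$ for all $v\in\mathbb{Z}^k$. The space $(\mathbb{Z}/q\mathbb{Z})^{\mathbb{Z}^k}$ carries the product topology of discrete spaces. The map $\pi$ is not required to commute with spatial shifts, nor to be surjective. *)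

theory Defs
  imports
    "HOL-Analysis.Analysis"
    "HOL-Number_Theory.Residues"
    "HOL-Combinatorics.Cycles"
begin

(* The lattice Z^d is the type "int ^ 'd" with d = CARD('d) (hence d >= 1), where 'd is an
   arbitrary finite index type.  The alphabet A is a set over an arbitrary type, so the points
   of A^(Z^d) are the elements of topspace (config_space A), i.e. the functions with all values
   in A.  Since functions are total, maps between configuration spaces also have values outside
   these carriers; these values are irrelevant and every property below is relativised. *)

type_synonym ('a, 'd) config = "int ^ 'd \<Rightarrow> 'a"

definition config_space :: "'a set \<Rightarrow> ('a, 'd::finite) config topology"
  where "config_space A = product_topology (\<lambda>_. discrete_topology A) UNIV"

definition shift :: "int ^ 'd \<Rightarrow> ('a, 'd::finite) config \<Rightarrow> ('a, 'd) config"
  where "shift v x = (\<lambda>u. x (u + v))"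

definition cellular_automaton ::
    "'a set \<Rightarrow> (('a, 'd::finite) config \<Rightarrow> ('a, 'd) config) \<Rightarrow> bool"
  where "cellular_automaton A F \<longleftrightarrow>
    finite A \<and> A \<noteq> {} \<and>
    continuous_map (config_space A) (config_space A) F \<and>
    (\<forall>v. \<forall>x \<in> topspace (config_space A). F (shift v x) = shift v (F x))"

(* Z/qZ is the library's ring residue_ring q, with carrier {0..q-1} and addition mod q. *)

definition clock :: "nat \<Rightarrow> (int, 'k::finite) config \<Rightarrow> (int, 'k) config"
  where "clock q x = (\<lambda>v. x v \<oplus>\<^bsub>residue_ring (int q)\<^esub> \<one>\<^bsub>residue_ring (int q)\<^esub>)"

definition periodic_point ::
    "'a set \<Rightarrow> (('a, 'd::finite) config \<Rightarrow> ('a, 'd) config) \<Rightarrow> ('a, 'd) config \<Rightarrow> bool"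
  where "periodic_point A F x \<longleftrightarrow>
    x \<in> topspace (config_space A) \<and> (\<exists>n\<ge>1. (F ^^ n) x = x)"

(* The least period of a periodic point x of F is the library's least_power F x, i.e.
   LEAST n. (F ^^ n) x = x \<and> n > 0. *)

end

theory Submission
  imports Defs
begin

text \<open>
  Fix a site of the clock and read the value of \<open>\<pi> x\<close> there.  Since \<open>\<pi> \<circ> F\<close> equals the clock
  applied after \<open>\<pi>\<close>, this value is a phase modulo \<open>q\<close> that advances by exactly 1 with every
  step of \<open>F\<close>, so after \<open>n\<close> steps it has advanced by \<open>n\<close> (\<open>semiconjugate_clock_iterate\<close>).
  If the orbit has returned to \<open>x\<close>, the phase is the same as at the start, and therefore
  \<open>n\<close> is congruent to 0 modulo \<open>q\<close>.  The least period is one such \<open>n\<close>.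
\<close>

lemma clock_apply_cong: "[clock q x v = x v + 1] (mod int q)"
  by (simp add: clock_def residue_ring_def cong_def)

lemma funpow_in_topspace:
  assumes "continuous_map X X F" "x \<in> topspace X"
  shows "(F ^^ n) x \<in> topspace X"
  using assms by (induction n) (auto simp: continuous_map_def)

text \<open>
  Each step of \<open>F\<close> adds 1 to the phase.  Stating this as a congruence keeps the reduction
  modulo \<open>q\<close> at each step out of the induction.  The orbit has to stay in \<open>S\<close> because the
  semiconjugacy is available only there.
\<close>
lemma semiconjugate_clock_iterate:
  assumes invariant: "\<And>n. (F ^^ n) x \<in> S"
    and semiconj: "\<And>y. y \<in> S \<Longrightarrow> \<pi> (F y) = clock q (\<pi> y)"
  shows "[\<pi> ((F ^^ n) x) v = \<pi> x v + int n] (mod int q)"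
proof (induction n)
  case 0
  show ?case by simp
next
  case (Suc n)
  have "[\<pi> ((F ^^ Suc n) x) v = \<pi> ((F ^^ n) x) v + 1] (mod int q)"
    using semiconj[OF invariant[of n]] clock_apply_cong by simp
  also have "[\<pi> ((F ^^ n) x) v + 1 = \<pi> x v + int n + 1] (mod int q)"
    using Suc.IH by (intro cong_add) auto
  finally show ?case by (simp add: algebra_simps)
qed

theorem proposition2p1:
  fixes q :: nat
    and A :: "'a set"
    and F :: "('a, 'd::finite) config \<Rightarrow> ('a, 'd) config"
  assumes "q \<ge> 2"
    and "cellular_automaton A F"
    and "\<exists>\<pi> :: ('a, 'd) config \<Rightarrow> (int, 'k::finite) config.
           continuous_map (config_space A) (config_space (carrier (residue_ring (int q)))) \<pi> \<and>
           (\<forall>x \<in> topspace (config_space A). \<pi> (F x) = clock q (\<pi> x))"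
  shows "(\<forall>x \<in> topspace (config_space A). \<forall>n\<ge>1. (F ^^ n) x = x \<longrightarrow> q dvd n) \<and>
         (\<forall>x. periodic_point A F x \<longrightarrow> q dvd least_power F x)"
proof -
  let ?X = "topspace (config_space A) :: ('a, 'd) config set"
  obtain \<pi> :: "('a, 'd) config \<Rightarrow> (int, 'k) config"
    where semiconj: "\<And>x. x \<in> ?X \<Longrightarrow> \<pi> (F x) = clock q (\<pi> x)"
    using assms(3) by blast
  have cont: "continuous_map (config_space A) (config_space A) F"
    using assms(2) by (simp add: cellular_automaton_def)
  have period_dvd: "q dvd n" if "x \<in> ?X" "(F ^^ n) x = x" for x n
  proof -
    have "[\<pi> ((F ^^ n) x) 0 = \<pi> x 0 + int n] (mod int q)"
      by (rule semiconjugate_clock_iterate[where S = ?X])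
        (use funpow_in_topspace[OF cont \<open>x \<in> ?X\<close>] semiconj in auto)
    then show ?thesis
      by (simp add: \<open>(F ^^ n) x = x\<close> cong_iff_dvd_diff)
  qed
  moreover have "q dvd least_power F x" if "periodic_point A F x" for x
  proof -
    obtain n where "x \<in> ?X" "n > 0" "(F ^^ n) x = x"
      using \<open>periodic_point A F x\<close> unfolding periodic_point_def by (auto simp: Suc_le_eq)
    then show ?thesis
      using least_powerI[of n F x] period_dvd by simp
  qed
  ultimately show ?thesis by blast
qed

end
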